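(* (Path-dependence) Let $0<\alpha<1$ and let $k^\circ(t)$, $c^\circ(t)$ be the limiting optimal capital and consumption paths described in the context. It takes infinite time for $k^\circ(t)$ and $c^\circ(t)$ to approach the steady states. Nevertheless, the time needed depends on the initial value $k(0)$. Formally, the difference of time needed for two initial values $k^a(0)\equiv\frac1a\alpha^{\frac{1}{1-\alpha}}$ and $k^b(0)\equiv\frac1b\alpha^{\frac{1}{1-\alpha}}$ is $$\frac{\ln\left(\frac{\ln a}{\ln b}\right)}{-\ln\alpha}>0,$$ where $a>b>0$.
   Context: For a horizon $T$, consider the problem of maximizing $\sum_{t=0}^{T}\ln c(t)$ subject to $c(t)+k(t+1)=k(t)^\alpha$, $k(0)$ given, $0<k(t)<1$ for $0\le t\le T$, and $k(T+1)=0$, with unique optimal solution $(k_T(t),c_T(t))$. The limiting paths $k^\circ(t)=\lim_{T\to\infty}k_T(t)$ and $c^\circ(t)=\lim_{T\to\infty}c_T(t)$ are $$k^\circ(t)=\alpha^{\frac{1}{1-\alpha}}\left(\frac{k(0)}{\alpha^{1/(1-\alpha)}}\right)^{\alpha^t},\qquad c^\circ(t)=(1-\alpha)\alpha^{\frac{\alpha}{1-\alpha}}\left(\frac{k(0)}{\alpha^{1/(1-\alpha)}}\right)^{\alpha^{t+1}}.$$ The steady-state values are $k_\infty=\lim_{t\to\infty}k^\circ(t)=\alpha^{\frac{1}{1-\alpha}}$ and $c_\infty=\lim_{t\to\infty}c^\circ(t)=(1-\alpha)\alpha^{\frac{\alpha}{1-\alpha}}$. Meaning of "difference of time needed": solving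 the formula for $k^\circ$ for $t$, the time at which the path started at $\frac1a\alpha^{1/(1-\alpha)}$ has the value $\kappa$ is $\frac{1}{\ln\alpha}\ln\left(\frac{1}{\ln a}\left(\ln\alpha^{1/(1-\alpha)}-\ln\kappa\right)\right)$, and likewise with $b$ in place of $a$; the difference of time needed is the limit, as $\kappa\to k_\infty$, of the time for $a$ minus the time for $b$.
   Formalization: For a>b>0 the value is negative if a<1 (e.g. a=0.9, b=0.8) and undefined if a≥1≥b; the formula is proved for b>1 and for a<1, positivity only for b>1. Infinite approach time is claimed for k(0) other than the steady state, with κ tending to it from the side of the paths. *)

theory Defs
  imports "HOL-Analysis.Analysis"
begin

(* The condition 0 < c t is the domain of the objective ln (c t); it has to be explicit because
   ln is total here. Plans are functions on all of nat, so they are set to 0 beyond the horizon: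
   this includes k (T + 1) = 0 and makes the optimal plan literally unique. *)
definition feasible_plan ::
  "real \<Rightarrow> real \<Rightarrow> nat \<Rightarrow> (nat \<Rightarrow> real) \<Rightarrow> (nat \<Rightarrow> real) \<Rightarrow> bool" where
  "feasible_plan \<alpha> k0 T k c \<longleftrightarrow>
     k 0 = k0 \<and>
     (\<forall>t\<le>T. 0 < k t \<and> k t < 1 \<and> 0 < c t \<and> c t + k (Suc t) = k t powr \<alpha>) \<and>
     (\<forall>t>T. k t = 0 \<and> c t = 0)"

definition utility :: "nat \<Rightarrow> (nat \<Rightarrow> real) \<Rightarrow> real" where
  "utility T c = (\<Sum>t=0..T. ln (c t))"

definition is_optimal_plan ::
  "real \<Rightarrow> real \<Rightarrow> nat \<Rightarrow> (nat \<Rightarrow> real) \<Rightarrow> (nat \<Rightarrow> real) \<Rightarrow> bool" where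
  "is_optimal_plan \<alpha> k0 T k c \<longleftrightarrow>
     feasible_plan \<alpha> k0 T k c \<and>
     (\<forall>k' c'. feasible_plan \<alpha> k0 T k' c' \<longrightarrow> utility T c' \<le> utility T c)"

definition optimal_plan :: "real \<Rightarrow> real \<Rightarrow> nat \<Rightarrow> (nat \<Rightarrow> real) \<times> (nat \<Rightarrow> real)" where
  "optimal_plan \<alpha> k0 T = (THE p. is_optimal_plan \<alpha> k0 T (fst p) (snd p))"

definition limit_capital :: "real \<Rightarrow> real \<Rightarrow> nat \<Rightarrow> real" where
  "limit_capital \<alpha> k0 t = lim (\<lambda>T. fst (optimal_plan \<alpha> k0 T) t)"

definition limit_consumption :: "real \<Rightarrow> real \<Rightarrow> nat \<Rightarrow> real" where
  "limit_consumption \<alpha> k0 t = lim (\<lambda>T. snd (optimal_plan \<alpha> k0 T) t)"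

definition steady_capital :: "real \<Rightarrow> real" where
  "steady_capital \<alpha> = \<alpha> powr (1 / (1 - \<alpha>))"

definition steady_consumption :: "real \<Rightarrow> real" where
  "steady_consumption \<alpha> = (1 - \<alpha>) * \<alpha> powr (\<alpha> / (1 - \<alpha>))"

(* The closed forms of the limiting paths, read as functions of a real time t. They agree with
   limit_capital and limit_consumption at integer times (limit_capital_eq and
   limit_consumption_eq below). *)
definition capital_path :: "real \<Rightarrow> real \<Rightarrow> real \<Rightarrow> real" where
  "capital_path \<alpha> k0 t = steady_capital \<alpha> * (k0 / steady_capital \<alpha>) powr (\<alpha> powr t)"

definition consumption_path :: "real \<Rightarrow> real \<Rightarrow> real \<Rightarrow> real" where
  "consumption_path \<alpha> k0 t =
     steady_consumption \<alpha> * (k0 / steady_capital \<alpha>) powr (\<alpha> powr (t + 1))"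

definition time_needed :: "(real \<Rightarrow> real) \<Rightarrow> real \<Rightarrow> real" where
  "time_needed f v = (THE t. f t = v)"


subsection \<open>Existence, uniqueness and limits of the optimal plans\<close>

definition savings :: "real \<Rightarrow> nat \<Rightarrow> real" where
  "savings \<alpha> n = \<alpha> * (1 - \<alpha> ^ n) / (1 - \<alpha> ^ Suc n)"

primrec opt_capital :: "real \<Rightarrow> real \<Rightarrow> nat \<Rightarrow> nat \<Rightarrow> real" where
  "opt_capital \<alpha> k0 T 0 = k0"
| "opt_capital \<alpha> k0 T (Suc t) = savings \<alpha> (T - t) * opt_capital \<alpha> k0 T t powr \<alpha>"

definition opt_consumption :: "real \<Rightarrow> real \<Rightarrow> nat \<Rightarrow> nat \<Rightarrow> real" where
  "opt_consumption \<alpha> k0 T t = opt_capital \<alpha> k0 T t powr \<alpha> - opt_capital \<alpha> k0 T (Suc t)"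

(* The value function of the problem with horizon n sends k to weight \<alpha> n * ln k + offset \<alpha> n. *)
definition weight :: "real \<Rightarrow> nat \<Rightarrow> real" where
  "weight \<alpha> n = \<alpha> * (1 - \<alpha> ^ Suc n) / (1 - \<alpha>)"

primrec offset :: "real \<Rightarrow> nat \<Rightarrow> real" where
  "offset \<alpha> 0 = 0"
| "offset \<alpha> (Suc n) =
     ln (1 - savings \<alpha> (Suc n)) + weight \<alpha> n * ln (savings \<alpha> (Suc n)) + offset \<alpha> n"

lemma savings_0 [simp]: "savings \<alpha> 0 = 0"
  by (simp add: savings_def)

lemma weight_0: "0 < \<alpha> \<Longrightarrow> \<alpha> < 1 \<Longrightarrow> weight \<alpha> 0 = \<alpha>"
  by (simp add: weight_def)

lemma weight_pos: assumes "0 < \<alpha>" "\<alpha> < 1" shows "0 < weight \<alpha> n"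
proof -
  have "\<alpha> ^ Suc n < 1" using assms by (intro power_Suc_less_one) auto
  thus ?thesis using assms by (simp add: weight_def)
qed

lemma weight_Suc: assumes "0 < \<alpha>" "\<alpha> < 1" shows "weight \<alpha> (Suc n) = \<alpha> * (1 + weight \<alpha> n)"
  using assms by (simp add: weight_def field_simps)

lemma savings_Suc: assumes "0 < \<alpha>" "\<alpha> < 1"
  shows "savings \<alpha> (Suc n) = weight \<alpha> n / (1 + weight \<alpha> n)"
proof -
  have "\<alpha> ^ Suc (Suc n) < 1" using assms by (intro power_Suc_less_one) auto
  moreover have "1 + weight \<alpha> n = (1 - \<alpha> ^ Suc (Suc n)) / (1 - \<alpha>)"
    using assms by (simp add: weight_def field_simps)
  ultimately show ?thesis using assms unfolding savings_def weight_def by simp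
qed

lemma savings_bounds: assumes "0 < \<alpha>" "\<alpha> < 1"
  shows "0 < savings \<alpha> (Suc n)" "savings \<alpha> (Suc n) < 1"
  using weight_pos[OF assms, of n] by (simp_all add: savings_Suc[OF assms])

lemma savings_le: assumes "0 < \<alpha>" "\<alpha> < 1" shows "0 \<le> savings \<alpha> n" "savings \<alpha> n < 1"
  using savings_bounds[OF assms] by (cases n; simp add: less_imp_le)+

lemma bellman:
  fixes A x y :: real
  assumes "0 < A" "0 < x" "x < y"
  defines "s \<equiv> A / (1 + A)"
  shows "ln (y - x) + A * ln x \<le> (1 + A) * ln y + ln (1 - s) + A * ln s"
    and "ln (y - x) + A * ln x = (1 + A) * ln y + ln (1 - s) + A * ln s \<Longrightarrow> x = s * y"
proof -
  have y: "0 < y" and s: "0 < s" "s < 1" using assms by auto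
  define u where "u = (y - x) / ((1 - s) * y)"
  define v where "v = x / (s * y)"
  have uv: "0 < u" "0 < v" using assms y s by (auto simp: u_def v_def)
  have lu: "ln u = ln (y - x) - ln (1 - s) - ln y"
    unfolding u_def using assms y s by (simp add: ln_div ln_mult)
  have lv: "ln v = ln x - ln s - ln y"
    unfolding v_def using assms y s by (simp add: ln_div ln_mult)
  have "1 - s = 1 / (1 + A)" using assms by (simp add: s_def field_simps)
  hence e: "(u - 1) + A * (v - 1) = 0"
    using assms y unfolding u_def v_def s_def by (simp add: field_simps)
  have d: "ln u + A * ln v = ln (y - x) + A * ln x - ((1 + A) * ln y + ln (1 - s) + A * ln s)"
    by (simp add: lu lv algebra_simps)
  have b: "ln u \<le> u - 1" "A * ln v \<le> A * (v - 1)"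
    using uv assms ln_le_minus_one by (auto intro: mult_left_mono)
  show "ln (y - x) + A * ln x \<le> (1 + A) * ln y + ln (1 - s) + A * ln s"
    using b d e by linarith
  assume "ln (y - x) + A * ln x = (1 + A) * ln y + ln (1 - s) + A * ln s"
  hence "A * ln v = A * (v - 1)" using b d e by linarith
  hence "ln v = v - 1" using assms by simp
  hence "v = 1" using uv ln_eq_minus_one by blast
  thus "x = s * y" using y s by (simp add: v_def)
qed

lemma utility_Suc: "utility (Suc T) c = ln (c 0) + utility T (\<lambda>t. c (Suc t))"
  unfolding utility_def by (simp only: sum.atLeast0_atMost_Suc_shift o_def)

lemma feasible_tail:
  "feasible_plan \<alpha> k0 (Suc T) k c \<Longrightarrow>
     feasible_plan \<alpha> (k 1) T (\<lambda>t. k (Suc t)) (\<lambda>t. c (Suc t))"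
  by (auto simp: feasible_plan_def)

lemma opt_capital_tail:
  "opt_capital \<alpha> k0 (Suc T) (Suc t) =
     opt_capital \<alpha> (savings \<alpha> (Suc T) * k0 powr \<alpha>) T t"
  by (induction t) auto

lemma utility_bound:
  assumes "0 < \<alpha>" "\<alpha> < 1" "feasible_plan \<alpha> k0 T k c"
  shows "utility T c \<le> weight \<alpha> T * ln k0 + offset \<alpha> T \<and>
    (utility T c = weight \<alpha> T * ln k0 + offset \<alpha> T \<longrightarrow> k = opt_capital \<alpha> k0 T)"
  using assms(3)
proof (induction T arbitrary: k0 k c)
  case 0
  hence k: "k 0 = k0" "0 < k0" "c 0 = k0 powr \<alpha>" "\<forall>t>0. k t = 0"
    by (auto simp: feasible_plan_def)
  have "k t = opt_capital \<alpha> k0 0 t" for t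
    using k by (cases t) auto
  thus ?case using k assms by (auto simp: utility_def weight_0 ln_powr)
next
  case (Suc T)
  let ?A = "weight \<alpha> T" and ?y = "k0 powr \<alpha>"
  have k: "k 0 = k0" "0 < k0" "0 < k 1" "c 0 = ?y - k 1" "0 < c 0"
    using Suc.prems by (auto simp: feasible_plan_def)
  note IH = Suc.IH[OF feasible_tail[OF Suc.prems]]
  have A: "0 < ?A" using weight_pos assms by blast
  have x: "k 1 < ?y" using k by simp
  note B = bellman[OF A k(3) x, folded savings_Suc[OF assms(1,2)]]
  have U: "utility (Suc T) c = ln (?y - k 1) + utility T (\<lambda>t. c (Suc t))"
    using k by (simp add: utility_Suc)
  have W: "weight \<alpha> (Suc T) * ln k0 = (1 + ?A) * ln ?y"
    using k assms by (simp add: weight_Suc ln_powr)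
  show ?case
  proof (intro conjI impI)
    show "utility (Suc T) c \<le> weight \<alpha> (Suc T) * ln k0 + offset \<alpha> (Suc T)"
      using IH B(1) unfolding U W offset.simps by linarith
    assume "utility (Suc T) c = weight \<alpha> (Suc T) * ln k0 + offset \<alpha> (Suc T)"
    hence "utility T (\<lambda>t. c (Suc t)) = ?A * ln (k 1) + offset \<alpha> T"
      and "ln (?y - k 1) + ?A * ln (k 1) =
        (1 + ?A) * ln ?y + ln (1 - savings \<alpha> (Suc T)) + ?A * ln (savings \<alpha> (Suc T))"
      using IH B(1) unfolding U W offset.simps by linarith+
    hence e: "(\<lambda>t. k (Suc t)) = opt_capital \<alpha> (k 1) T" "k 1 = savings \<alpha> (Suc T) * ?y"
      using IH B(2) by auto
    show "k = opt_capital \<alpha> k0 (Suc T)"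
    proof
      fix t show "k t = opt_capital \<alpha> k0 (Suc T) t"
      proof (cases t)
        case 0 thus ?thesis using k by simp
      next
        case (Suc n)
        have "k t = opt_capital \<alpha> (k 1) T n" using fun_cong[OF e(1), of n] Suc by simp
        thus ?thesis unfolding Suc opt_capital_tail e(2) .
      qed
    qed
  qed
qed

lemma opt_feasible:
  assumes "0 < \<alpha>" "\<alpha> < 1" "0 < k0" "k0 < 1"
  shows "feasible_plan \<alpha> k0 T (opt_capital \<alpha> k0 T) (opt_consumption \<alpha> k0 T)"
proof -
  let ?k = "opt_capital \<alpha> k0 T"
  have b: "t \<le> T \<Longrightarrow> 0 < ?k t \<and> ?k t < 1" for t
  proof (induction t)
    case 0 thus ?case using assms by simp
  next
    case (Suc t)
    then obtain n where n: "T - t = Suc n" by (cases "T - t") auto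
    have p: "0 < ?k t powr \<alpha>" "?k t powr \<alpha> < 1"
      using Suc assms powr_less_mono2[of \<alpha> "?k t" 1] by auto
    have "savings \<alpha> (Suc n) * ?k t powr \<alpha> < 1 * 1"
      using p savings_bounds[OF assms(1,2), of n] by (intro mult_strict_mono) auto
    thus ?case using p savings_bounds[OF assms(1,2), of n] n by simp
  qed
  have z: "?k t = 0" if t: "T < t" for t
  proof -
    obtain n where n: "t = Suc n" using t by (cases t) auto
    hence "T - n = 0" using t by simp
    thus ?thesis by (simp add: n)
  qed
  have c: "0 < opt_consumption \<alpha> k0 T t" if "t \<le> T" for t
    using b[OF that] savings_le(2)[OF assms(1,2), of "T - t"] by (simp add: opt_consumption_def)
  show ?thesis
    unfolding feasible_plan_def using b c z assms(1) by (auto simp: opt_consumption_def)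
qed

lemma opt_utility:
  assumes "0 < \<alpha>" "\<alpha> < 1" "0 < k0"
  shows "utility T (opt_consumption \<alpha> k0 T) = weight \<alpha> T * ln k0 + offset \<alpha> T"
  using assms(3)
proof (induction T arbitrary: k0)
  case 0
  thus ?case using assms by (simp add: utility_def opt_consumption_def weight_0 ln_powr)
next
  case (Suc T)
  let ?s = "savings \<alpha> (Suc T)" and ?y = "k0 powr \<alpha>"
  have s: "0 < ?s" "?s < 1" using savings_bounds assms by auto
  have tl: "(\<lambda>t. opt_consumption \<alpha> k0 (Suc T) (Suc t)) = opt_consumption \<alpha> (?s * ?y) T"
    unfolding opt_consumption_def opt_capital_tail ..
  have c0: "opt_consumption \<alpha> k0 (Suc T) 0 = (1 - ?s) * ?y"
    by (simp add: opt_consumption_def algebra_simps)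
  have "utility (Suc T) (opt_consumption \<alpha> k0 (Suc T)) =
      ln ((1 - ?s) * ?y) + (weight \<alpha> T * ln (?s * ?y) + offset \<alpha> T)"
    unfolding utility_Suc tl c0 using Suc s by (subst Suc.IH) auto
  also have "\<dots> = weight \<alpha> (Suc T) * ln k0 + offset \<alpha> (Suc T)"
  proof -
    have "ln ((1 - ?s) * ?y) = ln (1 - ?s) + \<alpha> * ln k0" "ln (?s * ?y) = ln ?s + \<alpha> * ln k0"
      using s Suc.prems by (simp_all add: ln_mult ln_powr)
    thus ?thesis using assms by (simp add: weight_Suc algebra_simps)
  qed
  finally show ?case .
qed

lemma is_optimal_plan_iff:
  assumes "0 < \<alpha>" "\<alpha> < 1" "0 < k0" "k0 < 1"
  shows "is_optimal_plan \<alpha> k0 T k c \<longleftrightarrow>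
    k = opt_capital \<alpha> k0 T \<and> c = opt_consumption \<alpha> k0 T"
proof
  assume o: "is_optimal_plan \<alpha> k0 T k c"
  hence f: "feasible_plan \<alpha> k0 T k c"
    and "utility T (opt_consumption \<alpha> k0 T) \<le> utility T c"
    using opt_feasible[OF assms] by (auto simp: is_optimal_plan_def)
  hence k: "k = opt_capital \<alpha> k0 T"
    using utility_bound[OF assms(1,2) f] opt_utility[OF assms(1-3)] by (metis order.antisym)
  have "c t = opt_consumption \<alpha> k0 T t" for t
  proof (cases "t \<le> T")
    case True
    hence "c t + k (Suc t) = k t powr \<alpha>" using f by (auto simp: feasible_plan_def)
    thus ?thesis unfolding k opt_consumption_def by linarith
  next
    case False
    thus ?thesis using f opt_feasible[OF assms, of T] by (auto simp: feasible_plan_def)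
  qed
  thus "k = opt_capital \<alpha> k0 T \<and> c = opt_consumption \<alpha> k0 T" using k by auto
next
  assume "k = opt_capital \<alpha> k0 T \<and> c = opt_consumption \<alpha> k0 T"
  thus "is_optimal_plan \<alpha> k0 T k c"
    using opt_feasible[OF assms] utility_bound[OF assms(1,2)] opt_utility[OF assms(1-3)]
    by (auto simp: is_optimal_plan_def)
qed

lemma optimal_plan_eq:
  assumes "0 < \<alpha>" "\<alpha> < 1" "0 < k0" "k0 < 1"
  shows "optimal_plan \<alpha> k0 T = (opt_capital \<alpha> k0 T, opt_consumption \<alpha> k0 T)"
  unfolding optimal_plan_def is_optimal_plan_iff[OF assms] by (rule the_equality) (auto simp: prod_eq_iff)

lemma savings_tendsto:
  assumes "0 < \<alpha>" "\<alpha> < 1"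
  shows "(\<lambda>T. savings \<alpha> (T - t)) \<longlonglongrightarrow> \<alpha>"
proof -
  have "(\<lambda>n. \<alpha> ^ n) \<longlonglongrightarrow> 0" using assms by (intro LIMSEQ_realpow_zero) auto
  moreover have "(\<lambda>n. \<alpha> ^ Suc n) \<longlonglongrightarrow> 0"
    using assms by (intro LIMSEQ_Suc LIMSEQ_realpow_zero) simp_all
  ultimately have "(\<lambda>n. savings \<alpha> n) \<longlonglongrightarrow> \<alpha> * (1 - 0) / (1 - 0)"
    unfolding savings_def
    by (intro tendsto_divide tendsto_mult tendsto_diff tendsto_const) auto
  hence "savings \<alpha> \<longlonglongrightarrow> \<alpha>" by simp
  moreover have "filterlim (\<lambda>T. T - t) sequentially sequentially"
    by (rule filterlim_minus_const_nat_at_top)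
  ultimately show ?thesis by (rule filterlim_compose)
qed

lemma steady_capital_pos: "0 < \<alpha> \<Longrightarrow> 0 < steady_capital \<alpha>"
  by (simp add: steady_capital_def)

lemma steady_capital_powr:
  assumes "0 < \<alpha>" "\<alpha> < 1"
  shows "steady_capital \<alpha> powr \<alpha> = \<alpha> powr (\<alpha> / (1 - \<alpha>))"
    and "\<alpha> * steady_capital \<alpha> powr \<alpha> = steady_capital \<alpha>"
proof -
  show *: "steady_capital \<alpha> powr \<alpha> = \<alpha> powr (\<alpha> / (1 - \<alpha>))"
    by (simp add: steady_capital_def powr_powr)
  have "\<alpha> * \<alpha> powr (\<alpha> / (1 - \<alpha>)) = \<alpha> powr (1 + \<alpha> / (1 - \<alpha>))"
    using assms by (simp add: powr_add)
  also have "1 + \<alpha> / (1 - \<alpha>) = 1 / (1 - \<alpha>)" using assms by (simp add: field_simps)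
  finally show "\<alpha> * steady_capital \<alpha> powr \<alpha> = steady_capital \<alpha>"
    unfolding * by (simp add: steady_capital_def)
qed

lemma capital_path_powr:
  assumes "0 < \<alpha>" "\<alpha> < 1" "0 < k0"
  shows "capital_path \<alpha> k0 t powr \<alpha> =
    steady_capital \<alpha> powr \<alpha> * (k0 / steady_capital \<alpha>) powr (\<alpha> powr (t + 1))"
  using assms steady_capital_pos[OF assms(1)]
  by (simp add: capital_path_def powr_mult powr_powr powr_add)

lemma opt_capital_tendsto:
  assumes "0 < \<alpha>" "\<alpha> < 1" "0 < k0"
  shows "(\<lambda>T. opt_capital \<alpha> k0 T t) \<longlonglongrightarrow> capital_path \<alpha> k0 (real t)"
proof (induction t)
  case 0
  show ?case using assms steady_capital_pos[OF assms(1)] by (simp add: capital_path_def)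
next
  case (Suc t)
  have "0 < capital_path \<alpha> k0 (real t)"
    using assms steady_capital_pos[OF assms(1)] by (simp add: capital_path_def)
  hence "(\<lambda>T. opt_capital \<alpha> k0 T (Suc t)) \<longlonglongrightarrow> \<alpha> * capital_path \<alpha> k0 (real t) powr \<alpha>"
    unfolding opt_capital.simps using assms Suc
    by (intro tendsto_mult savings_tendsto tendsto_powr tendsto_const) auto
  also have "\<alpha> * capital_path \<alpha> k0 (real t) powr \<alpha> = capital_path \<alpha> k0 (real (Suc t))"
    using steady_capital_powr(2)[OF assms(1,2)] unfolding capital_path_powr[OF assms]
    by (simp add: capital_path_def mult.assoc[symmetric] add.commute)
  finally show ?case .
qed

lemma opt_consumption_tendsto:
  assumes "0 < \<alpha>" "\<alpha> < 1" "0 < k0"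
  shows "(\<lambda>T. opt_consumption \<alpha> k0 T t) \<longlonglongrightarrow> consumption_path \<alpha> k0 (real t)"
proof -
  let ?q = "(k0 / steady_capital \<alpha>) powr (\<alpha> powr (real t + 1))"
  have "0 < capital_path \<alpha> k0 (real t)"
    using assms steady_capital_pos[OF assms(1)] by (simp add: capital_path_def)
  hence "(\<lambda>T. opt_consumption \<alpha> k0 T t) \<longlonglongrightarrow>
      capital_path \<alpha> k0 (real t) powr \<alpha> - capital_path \<alpha> k0 (real (Suc t))"
    unfolding opt_consumption_def using assms
    by (intro tendsto_diff tendsto_powr opt_capital_tendsto tendsto_const) auto
  also have "capital_path \<alpha> k0 (real (Suc t)) = (\<alpha> * steady_capital \<alpha> powr \<alpha>) * ?q"
    unfolding steady_capital_powr(2)[OF assms(1,2)] by (simp add: capital_path_def add.commute)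
  also have "capital_path \<alpha> k0 (real t) powr \<alpha> - (\<alpha> * steady_capital \<alpha> powr \<alpha>) * ?q =
      consumption_path \<alpha> k0 (real t)"
    unfolding capital_path_powr[OF assms] consumption_path_def steady_consumption_def
      steady_capital_powr(1)[OF assms(1,2)] by (simp add: algebra_simps)
  finally show ?thesis .
qed

lemma limit_capital_eq:
  assumes "0 < \<alpha>" "\<alpha> < 1" "0 < k0" "k0 < 1"
  shows "limit_capital \<alpha> k0 t = capital_path \<alpha> k0 (real t)"
  unfolding limit_capital_def using opt_capital_tendsto[OF assms(1-3)]
  by (simp add: optimal_plan_eq[OF assms] limI)

lemma limit_consumption_eq:
  assumes "0 < \<alpha>" "\<alpha> < 1" "0 < k0" "k0 < 1"
  shows "limit_consumption \<alpha> k0 t = consumption_path \<alpha> k0 (real t)"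
  unfolding limit_consumption_def using opt_consumption_tendsto[OF assms(1-3)]
  by (simp add: optimal_plan_eq[OF assms] limI)

lemma capital_path_eq_iff:
  assumes "0 < \<alpha>" "\<alpha> < 1" "0 < a" "0 < \<kappa>"
    and "1 < a \<and> \<kappa> < steady_capital \<alpha> \<or> a < 1 \<and> steady_capital \<alpha> < \<kappa>"
  shows "capital_path \<alpha> (1 / a * steady_capital \<alpha>) t = \<kappa> \<longleftrightarrow>
    t = 1 / ln \<alpha> * ln (1 / ln a * (ln (steady_capital \<alpha>) - ln \<kappa>))"
proof -
  let ?s = "steady_capital \<alpha>" and ?x = "1 / ln a * (ln (steady_capital \<alpha>) - ln \<kappa>)"
  have s: "0 < ?s" using assms steady_capital_pos by blast
  have la: "ln a \<noteq> 0" using assms by auto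
  have x: "0 < ?x"
    using assms s by (auto simp: zero_less_divide_iff)
  have p: "0 < capital_path \<alpha> (1 / a * ?s) t"
    using s assms by (simp add: capital_path_def)
  have "capital_path \<alpha> (1 / a * ?s) t = \<kappa> \<longleftrightarrow> ln (capital_path \<alpha> (1 / a * ?s) t) = ln \<kappa>"
    using p assms by simp
  also have "ln (capital_path \<alpha> (1 / a * ?s) t) = ln ?s - \<alpha> powr t * ln a"
    using s assms by (simp add: capital_path_def ln_mult ln_powr ln_div)
  also have "ln ?s - \<alpha> powr t * ln a = ln \<kappa> \<longleftrightarrow> \<alpha> powr t = ?x"
    using la by (auto simp: field_simps)
  also have "\<dots> \<longleftrightarrow> ln (\<alpha> powr t) = ln ?x"
    using ln_inj_iff[of "\<alpha> powr t" ?x] x assms by simp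
  also have "\<dots> \<longleftrightarrow> t = 1 / ln \<alpha> * ln ?x"
    using assms by (auto simp: ln_powr field_simps)
  finally show ?thesis .
qed

lemma time_needed_capital_path:
  assumes "0 < \<alpha>" "\<alpha> < 1" "0 < a" "0 < \<kappa>"
    and "1 < a \<and> \<kappa> < steady_capital \<alpha> \<or> a < 1 \<and> steady_capital \<alpha> < \<kappa>"
  shows "time_needed (capital_path \<alpha> (1 / a * steady_capital \<alpha>)) \<kappa> =
    1 / ln \<alpha> * ln (1 / ln a * (ln (steady_capital \<alpha>) - ln \<kappa>))"
  unfolding time_needed_def capital_path_eq_iff[OF assms] by simp

end

theory Submission
  imports Defs
begin

text \<open>
  Both limiting paths have the form \<open>f t = S * q powr (\<alpha> powr (t + d))\<close>, so that
  \<open>ln (f t) - ln S = \<alpha> powr (t + d) * ln q\<close>: the logarithmic distance to the steady state \<open>S\<close>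
  decays geometrically but never vanishes, and a value close to \<open>S\<close> is reached only at a late time.
  For the capital path \<open>q = 1 / a\<close>, so two initial values differ by the constant factor
  \<open>ln a / ln b\<close> in logarithmic distance, and making up for it takes \<open>ln (ln a / ln b) / - ln \<alpha>\<close>.
\<close>

lemma ln_double_power:
  fixes \<alpha> q S t d :: real
  assumes "0 < S" "0 < q"
  shows "ln (S * q powr (\<alpha> powr (t + d))) = ln S + \<alpha> powr (t + d) * ln q"
  using assms by (simp add: ln_mult ln_powr)

lemma double_power_neq:
  fixes \<alpha> q S t d :: real
  assumes "0 < \<alpha>" "0 < S" "0 < q" "q \<noteq> 1"
  shows "S * q powr (\<alpha> powr (t + d)) \<noteq> S"
  using assms ln_double_power[of S q \<alpha> t d] by auto

text \<open>The exponent \<open>\<alpha> powr (real n + d)\<close> tends to 0, and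
  \<open>q powr 0 = 1\<close> for positive \<open>q\<close>.\<close>

lemma double_power_tendsto:
  fixes \<alpha> q S d :: real
  assumes "0 < \<alpha>" "\<alpha> < 1" "0 < q"
  shows "(\<lambda>n. S * q powr (\<alpha> powr (real n + d))) \<longlonglongrightarrow> S"
proof -
  have "(\<lambda>n. \<alpha> ^ n * \<alpha> powr d) \<longlonglongrightarrow> 0 * \<alpha> powr d"
    using assms by (intro tendsto_mult LIMSEQ_realpow_zero tendsto_const) auto
  hence "(\<lambda>n. \<alpha> powr (real n + d)) \<longlonglongrightarrow> 0"
    using assms by (simp add: powr_add powr_realpow)
  hence "(\<lambda>n. S * q powr (\<alpha> powr (real n + d))) \<longlonglongrightarrow> S * q powr 0"
    using assms by (intro tendsto_mult tendsto_powr tendsto_const) auto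
  thus ?thesis using assms by simp
qed

text \<open>Since \<open>ln q\<close> is nonzero and \<open>\<alpha>\<close> is not 1, the path is
  injective in real time, so the \<open>THE\<close> in \<open>time_needed\<close> picks out the
  right time.\<close>

lemma time_needed_double_power:
  fixes \<alpha> q S d t :: real
  assumes "0 < \<alpha>" "\<alpha> < 1" "0 < S" "0 < q" "q \<noteq> 1"
  shows "time_needed (\<lambda>t. S * q powr (\<alpha> powr (t + d))) (S * q powr (\<alpha> powr (t + d))) = t"
  unfolding time_needed_def
proof (rule the_equality)
  fix u assume "S * q powr (\<alpha> powr (u + d)) = S * q powr (\<alpha> powr (t + d))"
  hence "ln (S * q powr (\<alpha> powr (u + d))) = ln (S * q powr (\<alpha> powr (t + d)))"
    by (rule arg_cong)
  hence "\<alpha> powr (u + d) = \<alpha> powr (t + d)"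
    unfolding ln_double_power[OF assms(3,4)] using assms(4,5) by simp
  thus "u = t" using assms powr_inj[of \<alpha> "u + d" "t + d"] by simp
qed simp

text \<open>A value \<open>f t\<close> has logarithmic distance
  \<open>\<alpha> powr (t + d) * \<bar>ln q\<bar>\<close> from \<open>S\<close>, so being close to
  \<open>S\<close> forces \<open>t\<close> to be large. The filter is restricted to
  \<open>range f\<close> because \<open>time_needed\<close> is an unspecified value outside
  it.\<close>

lemma filterlim_time_needed_double_power:
  fixes \<alpha> q S d :: real
  assumes "0 < \<alpha>" "\<alpha> < 1" "0 < S" "0 < q" "q \<noteq> 1"
  defines "f \<equiv> \<lambda>t. S * q powr (\<alpha> powr (t + d))"
  shows "filterlim (time_needed f) at_top (at S within range f)"
  unfolding filterlim_at_top
proof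
  fix Z :: real
  \<comment> \<open>This is the logarithmic distance from \<open>S\<close> at time \<open>Z\<close>;
    strictly closer values are reached only after \<open>Z\<close>.\<close>
  define \<epsilon> where "\<epsilon> = \<alpha> powr (Z + d) * \<bar>ln q\<bar>"
  have "\<epsilon> > 0" using assms by (simp add: \<epsilon>_def)
  have "(ln \<longlongrightarrow> ln S) (at S within range f)"
    using assms by (intro tendsto_ln tendsto_ident_at) auto
  hence "\<forall>\<^sub>F v in at S within range f. \<bar>ln v - ln S\<bar> < \<epsilon>"
    using \<open>\<epsilon> > 0\<close> by (auto dest: tendstoD simp: dist_real_def)
  moreover have "\<forall>\<^sub>F v in at S within range f. v \<in> range f"
    by (simp add: eventually_at_filter)
  ultimately show "\<forall>\<^sub>F v in at S within range f. Z \<le> time_needed f v"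
  proof eventually_elim
    case (elim v)
    then obtain t where v: "v = f t" by auto
    have "ln v - ln S = \<alpha> powr (t + d) * ln q"
      unfolding v f_def ln_double_power[OF assms(3,4)] by simp
    hence "\<alpha> powr (t + d) * \<bar>ln q\<bar> < \<alpha> powr (Z + d) * \<bar>ln q\<bar>"
      using elim by (simp add: \<epsilon>_def abs_mult)
    hence "\<alpha> powr (t + d) < \<alpha> powr (Z + d)"
      by (simp add: mult_less_cancel_right)
    hence "Z < t"
      using assms powr_mono'[of "t + d" "Z + d" \<alpha>] by linarith
    moreover have "time_needed f v = t"
      unfolding v f_def using assms by (intro time_needed_double_power) auto
    ultimately show ?case by simp
  qed
qed

lemma capital_path_double_power:
  "capital_path \<alpha> k0 =
    (\<lambda>t. steady_capital \<alpha> * (k0 / steady_capital \<alpha>) powr (\<alpha> powr (t + 0)))"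
  by (simp add: capital_path_def fun_eq_iff)

lemma consumption_path_double_power:
  "consumption_path \<alpha> k0 =
    (\<lambda>t. steady_consumption \<alpha> * (k0 / steady_capital \<alpha>) powr (\<alpha> powr (t + 1)))"
  by (simp add: consumption_path_def fun_eq_iff)

lemma steady_consumption_pos: "0 < \<alpha> \<Longrightarrow> \<alpha> < 1 \<Longrightarrow> 0 < steady_consumption \<alpha>"
  by (simp add: steady_consumption_def)

text \<open>The difference is already constant in \<open>\<kappa>\<close>:
  \<open>ln (D / ln a)\<close> and \<open>ln (D / ln b)\<close> differ by
  \<open>ln (ln a / ln b)\<close>, whatever \<open>D\<close> is. The two cases are approach to the
  steady state from below and from above.\<close>

lemma time_needed_capital_path_diff:
  assumes "0 < \<alpha>" "\<alpha> < 1" "0 < a" "0 < b" "0 < \<kappa>"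
    and "1 < a \<and> 1 < b \<and> \<kappa> < steady_capital \<alpha> \<or> a < 1 \<and> b < 1 \<and> steady_capital \<alpha> < \<kappa>"
  shows "time_needed (capital_path \<alpha> (1 / a * steady_capital \<alpha>)) \<kappa>
      - time_needed (capital_path \<alpha> (1 / b * steady_capital \<alpha>)) \<kappa>
    = ln (ln a / ln b) / (- ln \<alpha>)"
proof -
  define D where "D = ln (steady_capital \<alpha>) - ln \<kappa>"
  have s: "0 < steady_capital \<alpha>" using assms steady_capital_pos by blast
  \<comment> \<open>In the second case \<open>D\<close>, \<open>ln a\<close> and \<open>ln b\<close>
    are all negative, so only their quotients may be put under \<open>ln\<close>.\<close>
  have pos: "0 < D / ln a" "0 < D / ln b" "0 < ln a / ln b"
    using assms s by (auto simp: D_def zero_less_divide_iff)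
  have "D / ln b = (D / ln a) * (ln a / ln b)" using pos by auto
  hence "ln (D / ln b) = ln (D / ln a) + ln (ln a / ln b)"
    using pos by (simp only: ln_mult_pos)
  moreover have "time_needed (capital_path \<alpha> (1 / a * steady_capital \<alpha>)) \<kappa> = 1 / ln \<alpha> * ln (D / ln a)"
    "time_needed (capital_path \<alpha> (1 / b * steady_capital \<alpha>)) \<kappa> = 1 / ln \<alpha> * ln (D / ln b)"
    using assms by (subst time_needed_capital_path; auto simp: D_def)+
  ultimately show ?thesis using assms by (simp add: field_simps)
qed

text \<open>A path started at the steady state stays there, hence
  \<open>k0 \<noteq> steady_capital \<alpha>\<close>. If \<open>b < 1 < a\<close>, the two paths lie
  on opposite sides of the steady state and share no value. If \<open>b < a < 1\<close>, then
  \<open>ln a / ln b\<close> lies between 0 and 1 and the difference is negative, so positivity is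
  claimed only for \<open>1 < b\<close>.\<close>

theorem proposition3:
  fixes \<alpha> a b :: real
  assumes "0 < \<alpha>" "\<alpha> < 1"
    and "0 < b" "b < a"
  shows
    "(\<forall>k0. 0 < k0 \<and> k0 < 1 \<and> k0 \<noteq> steady_capital \<alpha> \<longrightarrow>
        limit_capital \<alpha> k0 \<longlonglongrightarrow> steady_capital \<alpha> \<and>
        limit_consumption \<alpha> k0 \<longlonglongrightarrow> steady_consumption \<alpha> \<and>
        (\<forall>t. limit_capital \<alpha> k0 t \<noteq> steady_capital \<alpha> \<and>
             limit_consumption \<alpha> k0 t \<noteq> steady_consumption \<alpha>) \<and>
        filterlim (time_needed (capital_path \<alpha> k0)) at_top
          (at (steady_capital \<alpha>) within range (capital_path \<alpha> k0)) \<and>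
        filterlim (time_needed (consumption_path \<alpha> k0)) at_top
          (at (steady_consumption \<alpha>) within range (consumption_path \<alpha> k0))) \<and>
     (1 < b \<longrightarrow>
        ((\<lambda>\<kappa>. time_needed (capital_path \<alpha> (1 / a * steady_capital \<alpha>)) \<kappa>
              - time_needed (capital_path \<alpha> (1 / b * steady_capital \<alpha>)) \<kappa>)
           \<longlongrightarrow> ln (ln a / ln b) / (- ln \<alpha>)) (at_left (steady_capital \<alpha>)) \<and>
        ln (ln a / ln b) / (- ln \<alpha>) > 0) \<and>
     (a < 1 \<longrightarrow>
        ((\<lambda>\<kappa>. time_needed (capital_path \<alpha> (1 / a * steady_capital \<alpha>)) \<kappa>
              - time_needed (capital_path \<alpha> (1 / b * steady_capital \<alpha>)) \<kappa>)
           \<longlongrightarrow> ln (ln a / ln b) / (- ln \<alpha>)) (at_right (steady_capital \<alpha>)))"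
proof (intro conjI allI impI; (elim conjE)?)
  fix k0 assume k0: "0 < k0" "k0 < 1" "k0 \<noteq> steady_capital \<alpha>"
  have s: "0 < steady_capital \<alpha>" "0 < steady_consumption \<alpha>"
    using assms steady_capital_pos steady_consumption_pos by auto
  have q: "0 < k0 / steady_capital \<alpha>" "k0 / steady_capital \<alpha> \<noteq> 1"
    using k0 s by auto
  \<comment> \<open>The limits over the horizon become closed forms sampled at integer times, to
    which the double-power lemmas apply.\<close>
  have lim: "limit_capital \<alpha> k0 = (\<lambda>t. capital_path \<alpha> k0 (real t))"
    "limit_consumption \<alpha> k0 = (\<lambda>t. consumption_path \<alpha> k0 (real t))"
    using limit_capital_eq limit_consumption_eq assms k0 by auto
  show "limit_capital \<alpha> k0 \<longlonglongrightarrow> steady_capital \<alpha>"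
    unfolding lim capital_path_double_power by (rule double_power_tendsto[OF assms(1,2) q(1)])
  show "limit_consumption \<alpha> k0 \<longlonglongrightarrow> steady_consumption \<alpha>"
    unfolding lim consumption_path_double_power by (rule double_power_tendsto[OF assms(1,2) q(1)])
  show "limit_capital \<alpha> k0 t \<noteq> steady_capital \<alpha>" for t
    unfolding lim capital_path_double_power by (rule double_power_neq[OF assms(1) s(1) q])
  show "limit_consumption \<alpha> k0 t \<noteq> steady_consumption \<alpha>" for t
    unfolding lim consumption_path_double_power by (rule double_power_neq[OF assms(1) s(2) q])
  show "filterlim (time_needed (capital_path \<alpha> k0)) at_top
      (at (steady_capital \<alpha>) within range (capital_path \<alpha> k0))"
    unfolding capital_path_double_power
    by (rule filterlim_time_needed_double_power[OF assms(1,2) s(1) q])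
  show "filterlim (time_needed (consumption_path \<alpha> k0)) at_top
      (at (steady_consumption \<alpha>) within range (consumption_path \<alpha> k0))"
    unfolding consumption_path_double_power
    by (rule filterlim_time_needed_double_power[OF assms(1,2) s(2) q])
next
  assume b: "1 < b"
  \<comment> \<open>The left neighbourhood is cut off at 0 to keep \<open>ln \<kappa>\<close>
    meaningful; on it the difference is constant.\<close>
  have "\<forall>\<^sub>F \<kappa> in at_left (steady_capital \<alpha>). \<kappa> \<in> {0<..<steady_capital \<alpha>}"
    using steady_capital_pos[OF assms(1)] by (rule eventually_at_left_real)
  hence "\<forall>\<^sub>F \<kappa> in at_left (steady_capital \<alpha>).
      time_needed (capital_path \<alpha> (1 / a * steady_capital \<alpha>)) \<kappa>
      - time_needed (capital_path \<alpha> (1 / b * steady_capital \<alpha>)) \<kappa> = ln (ln a / ln b) / (- ln \<alpha>)"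
    by eventually_elim (rule time_needed_capital_path_diff; use assms b in auto)
  thus "((\<lambda>\<kappa>. time_needed (capital_path \<alpha> (1 / a * steady_capital \<alpha>)) \<kappa>
      - time_needed (capital_path \<alpha> (1 / b * steady_capital \<alpha>)) \<kappa>)
      \<longlongrightarrow> ln (ln a / ln b) / (- ln \<alpha>)) (at_left (steady_capital \<alpha>))"
    by (rule tendsto_eventually)
  have "1 < ln a / ln b" using assms b by simp
  thus "ln (ln a / ln b) / (- ln \<alpha>) > 0"
    using assms by (intro divide_pos_pos) auto
next
  assume a: "a < 1"
  have "\<forall>\<^sub>F \<kappa> in at_right (steady_capital \<alpha>). steady_capital \<alpha> < \<kappa>"
    by (rule eventually_at_right_less)
  hence "\<forall>\<^sub>F \<kappa> in at_right (steady_capital \<alpha>).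
      time_needed (capital_path \<alpha> (1 / a * steady_capital \<alpha>)) \<kappa>
      - time_needed (capital_path \<alpha> (1 / b * steady_capital \<alpha>)) \<kappa> = ln (ln a / ln b) / (- ln \<alpha>)"
    by eventually_elim
      (rule time_needed_capital_path_diff; use assms a steady_capital_pos[OF assms(1)] in auto)
  thus "((\<lambda>\<kappa>. time_needed (capital_path \<alpha> (1 / a * steady_capital \<alpha>)) \<kappa>
      - time_needed (capital_path \<alpha> (1 / b * steady_capital \<alpha>)) \<kappa>)
      \<longlongrightarrow> ln (ln a / ln b) / (- ln \<alpha>)) (at_right (steady_capital \<alpha>))"
    by (rule tendsto_eventually)
qed

end
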